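(* Let $S$ be a semiring and let $M$ be an $S$-semimodule. Then the following statements are equivalent: (1) $M$ is a subtractive $S$-semimodule; (2) for all $f \in S[X]$ and $g \in M[X]$, if $\deg(g) = m$, then $c(f)^{m+1} c(g) = c(f)^m c(fg)$.
   Context: A semiring $(S,+,\cdot,0,1)$ is commutative: $(S,+,0)$ and $(S,\cdot,1)$ are commutative monoids, $1\neq 0$, multiplication distributes over addition, and $s\cdot 0=0$ for all $s$. An ideal of $S$ is a nonempty subset closed under addition and under multiplication by elements of $S$. An $S$-semimodule $M$ is a commutative monoid $(M,+,0)$ with a scalar product $S\times M\to M$ satisfying $s(m+n)=sm+sn$, $(s+t)m=sm+tm$, $(st)m=s(tm)$, $s\cdot 0=0$, $0\cdot m=0$, $1\cdot m=m$. An $S$-subsemimodule of $M$ is a nonempty subset closed under addition and scalar multiplication. A subsemimodule $N$ of $M$ is subtractive if for all $m,n\in M$, $m\in N$ and $m+n\in N$ imply $n\in N$. $M$ is subtractive if every $S$-subsemimodule of $M$ is subtractive. $S[X]$ is the usual polynomial semiring, and $M[X]$ (polynomials with coefficients in $M$) is an $S[X]$-semimodule under the usual operations. For $f\in S[X]$, $c(f)$ is the ideal of $S$ generated by the coefficients of $f$; for $g\in M[X]$, $c(g)$ is the $S$-subsemimodule of $M$ generated by the coefficients of $g$. If $g=b_0+b_1X+\cdots+b_mX^m$ with $b_m\ne 0$, then $\deg(g)=m$. For an ideal $I$ of $S$ and a subsemimodule $N$ of $M$, $IN$ is the set of finite sums $\sum s_i n_i$ with $s_i\in I$, $n_i\in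 N$; powers of ideals are defined accordingly, with $I^0=S$. *)

theory Defs
  imports "HOL-Computational_Algebra.Polynomial"
begin

text \<open>
  Commutative semirings are the types of class \<open>comm_semiring_1\<close>, which includes
  \<open>0 \<noteq> 1\<close> and \<open>0 * s = 0\<close>. The polynomials \<open>S[X]\<close> and \<open>M[X]\<close> are the library types
  \<open>'s poly\<close> and \<open>'m poly\<close>, which only need a zero in the coefficient type.
\<close>

definition is_ideal :: "'s::comm_semiring_1 set \<Rightarrow> bool" where
  "is_ideal I \<longleftrightarrow> I \<noteq> {} \<and> (\<forall>a\<in>I. \<forall>b\<in>I. a + b \<in> I) \<and> (\<forall>s. \<forall>a\<in>I. s * a \<in> I)"

text \<open>
  The set of finite sums of products \<open>op s n\<close> with \<open>s \<in> I\<close> and \<open>n \<in> N\<close>; the operation is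
  the multiplication of \<open>S\<close> for a product of ideals, and the scalar product of \<open>M\<close> for \<open>IN\<close>.
\<close>

definition set_prod :: "('s \<Rightarrow> 'm \<Rightarrow> 'm) \<Rightarrow> 's set \<Rightarrow> 'm::comm_monoid_add set \<Rightarrow> 'm set" where
  "set_prod op I N =
     {(\<Sum>k<n. op (s k) (x k)) | (n::nat) s x. \<forall>k<n. s k \<in> I \<and> x k \<in> N}"

primrec ideal_power :: "'s::comm_semiring_1 set \<Rightarrow> nat \<Rightarrow> 's set" where
  "ideal_power I 0 = UNIV"
| "ideal_power I (Suc n) = set_prod (*) I (ideal_power I n)"

text \<open>\<open>range (coeff f)\<close> also contains \<open>0\<close>, which lies in every ideal and subsemimodule.\<close>

definition content_ideal :: "'s::comm_semiring_1 poly \<Rightarrow> 's set" where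
  "content_ideal f = is_ideal hull range (coeff f)"

locale semimodule =
  fixes scale :: "'s::comm_semiring_1 \<Rightarrow> 'm::comm_monoid_add \<Rightarrow> 'm"  (infixr \<open>*s\<close> 75)
  assumes scale_right_distrib: "s *s (x + y) = s *s x + s *s y"
    and scale_left_distrib: "(s + t) *s x = s *s x + t *s x"
    and scale_assoc: "(s * t) *s x = s *s (t *s x)"
    and scale_zero_right: "s *s 0 = 0"
    and scale_zero_left: "0 *s x = 0"
    and scale_one: "1 *s x = x"
begin

definition subsemimodule :: "'m set \<Rightarrow> bool" where
  "subsemimodule N \<longleftrightarrow> N \<noteq> {} \<and> (\<forall>x\<in>N. \<forall>y\<in>N. x + y \<in> N) \<and> (\<forall>s. \<forall>x\<in>N. s *s x \<in> N)"

definition subtractive_subsemimodule :: "'m set \<Rightarrow> bool" where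
  "subtractive_subsemimodule N \<longleftrightarrow>
     subsemimodule N \<and> (\<forall>x y. x \<in> N \<and> x + y \<in> N \<longrightarrow> y \<in> N)"

definition subtractive :: bool where
  "subtractive \<longleftrightarrow> (\<forall>N. subsemimodule N \<longrightarrow> subtractive_subsemimodule N)"

definition content_submodule :: "'m poly \<Rightarrow> 'm set" where
  "content_submodule g = subsemimodule hull range (coeff g)"

definition poly_scale :: "'s poly \<Rightarrow> 'm poly \<Rightarrow> 'm poly" where
  "poly_scale f g =
     (\<Sum>i\<le>degree f. \<Sum>j\<le>degree g. monom (coeff f i *s coeff g j) (i + j))"

lemma coeff_poly_scale:
  "coeff (poly_scale f g) k = (\<Sum>i\<le>k. coeff f i *s coeff g (k - i))"
proof -
  have "coeff (poly_scale f g) k =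
      (\<Sum>i\<le>degree f. \<Sum>j\<le>degree g. if i + j = k then coeff f i *s coeff g j else 0)"
    by (simp add: poly_scale_def coeff_sum)
  also have "\<dots> = (\<Sum>i\<le>degree f. if i \<le> k then coeff f i *s coeff g (k - i) else 0)"
  proof (rule sum.cong[OF refl])
    fix i
    show "(\<Sum>j\<le>degree g. if i + j = k then coeff f i *s coeff g j else 0) =
        (if i \<le> k then coeff f i *s coeff g (k - i) else 0)"
    proof (cases "i \<le> k")
      case True
      then have "(\<Sum>j\<le>degree g. if i + j = k then coeff f i *s coeff g j else 0) =
          (\<Sum>j\<le>degree g. if j = k - i then coeff f i *s coeff g j else 0)"
        by (intro sum.cong) auto
      with True show ?thesis
        by (simp add: coeff_eq_0 scale_zero_right)
    next
      case False
      then show ?thesis by (intro trans[OF sum.neutral]) auto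
    qed
  qed
  also have "\<dots> = (\<Sum>i\<in>{..degree f} \<inter> {..k}. coeff f i *s coeff g (k - i))"
    by (subst sum.inter_restrict) simp_all
  also have "\<dots> = (\<Sum>i\<le>k. coeff f i *s coeff g (k - i))"
  proof (rule sum.mono_neutral_left)
    show "\<forall>i\<in>{..k} - {..degree f} \<inter> {..k}. coeff f i *s coeff g (k - i) = 0"
      by (metis DiffE IntI atMost_iff le_degree scale_zero_left)
  qed auto
  finally show ?thesis .
qed

end

end

theory Submission imports Defs begin

text \<open>
  Write \<open>I = c(f)\<close>, \<open>C = c(fg)\<close> and \<open>N = I\<^sup>m C\<close>. The inclusion of \<open>N\<close> in \<open>I\<^sup>m\<^sup>+\<^sup>1 c(g)\<close> holds over
  every semiring, since the coefficients of \<open>fg\<close> lie in \<open>I c(g)\<close>. The opposite inclusion is the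
  Dedekind-Mertens lemma. Over a ring it is proved by solving the equations for the coefficients
  of \<open>fg\<close> one after the other; without negatives, subtractivity of \<open>M\<close> must replace each
  subtraction, and it does so only for a sum that lies in a subsemimodule together with one of
  its two summands. The proof is therefore arranged so that whenever a term is cancelled, it is
  already known to lie in the subsemimodule in question.

  This is a double induction, on the degree \<open>m\<close> of \<open>g\<close> and on the length of \<open>f\<close>. Let \<open>t\<close> be the
  leading coefficient of \<open>f\<close> and \<open>b\<close> that of \<open>g\<close>. The product \<open>tb\<close> is a coefficient of \<open>fg\<close>. If
  \<open>g\<close> is a constant, all products \<open>a b\<close> with \<open>a\<close> a coefficient of \<open>f\<close> are such coefficients, which
  settles the case \<open>m = 0\<close>; otherwise there are three steps.

  \<^item> Removing the leading term \<open>tb X\<^sup>m\<close> from \<open>tg\<close> leaves a polynomial \<open>g'\<close> of smaller degree bound.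
    The coefficients of \<open>t fg\<close> and of \<open>f tb X\<^sup>m\<close> lie in \<open>IC\<close>, hence so do those of \<open>fg'\<close>. The
    induction hypothesis for \<open>g'\<close> yields \<open>I\<^sup>m t c(g) \<subseteq> N\<close> (\<open>leading_coefficient_mult\<close>).

  \<^item> Removing the leading term from \<open>f\<close> leaves a shorter polynomial \<open>f'\<close>, with content \<open>J\<close>. By the
    first step \<open>I\<^sup>m\<close> times the coefficients of \<open>tg\<close> lies in \<open>N\<close>, so \<open>I\<^sup>m c(f'g) \<subseteq> N\<close>, and the
    induction hypothesis for \<open>f'\<close> yields \<open>J\<^sup>m\<^sup>+\<^sup>1 c(g) \<subseteq> N\<close>.

  \<^item> Since \<open>I\<close> is generated by \<open>t\<close> and \<open>J\<close>, every product of \<open>m + 1\<close> generators of \<open>I\<close> either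
    contains the factor \<open>t\<close> or lies in \<open>J\<^sup>m\<^sup>+\<^sup>1\<close> (\<open>ideal_power_insert_subset\<close>). Both cases are covered.

  Conversely, let \<open>x\<close> and \<open>x + y\<close> lie in a subsemimodule, with \<open>x \<noteq> 0\<close>, as \<open>y = x + y\<close> otherwise.
  The polynomials \<open>f = 1 + X\<close> and
  \<open>g = x + yX + xX\<^sup>2\<close> satisfy \<open>c(f) = S\<close> and \<open>fg = x + (x + y)X + (x + y)X\<^sup>2 + xX\<^sup>3\<close>, so the content
  formula reads \<open>c(g) = c(fg)\<close> and puts \<open>y\<close> into the subsemimodule generated by \<open>x\<close> and \<open>x + y\<close>.
\<close>

section \<open>Ideals as subsemimodules of the semiring\<close>

text \<open>
  Everything proved for subsemimodules, hulls and products applies through this interpretation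
  to ideals and their powers.
\<close>

interpretation semiring: semimodule "(*) :: 's::comm_semiring_1 \<Rightarrow> 's \<Rightarrow> 's"
  by unfold_locales (simp_all add: algebra_simps)

lemma is_ideal_iff_subsemimodule: "is_ideal I \<longleftrightarrow> semiring.subsemimodule I"
  by (simp add: is_ideal_def semiring.subsemimodule_def)

section \<open>Subsemimodules and their products with ideals\<close>

context semimodule
begin

lemma subsemimodule_add: "subsemimodule N \<Longrightarrow> x \<in> N \<Longrightarrow> y \<in> N \<Longrightarrow> x + y \<in> N"
  by (simp add: subsemimodule_def)

lemma subsemimodule_scale: "subsemimodule N \<Longrightarrow> x \<in> N \<Longrightarrow> s *s x \<in> N"
  by (simp add: subsemimodule_def)

lemma subsemimodule_zero: "subsemimodule N \<Longrightarrow> 0 \<in> N"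
  by (metis all_not_in_conv scale_zero_left subsemimodule_def)

lemma subsemimodule_sum:
  "subsemimodule N \<Longrightarrow> (\<And>i. i \<in> A \<Longrightarrow> h i \<in> N) \<Longrightarrow> sum h A \<in> N"
  by (induction A rule: infinite_finite_induct) (auto simp: subsemimodule_zero subsemimodule_add)

lemma subsemimodule_hull: "subsemimodule (subsemimodule hull X)"
proof (rule hull_in)
  fix T assume T: "Ball T subsemimodule"
  then have "0 \<in> \<Inter> T" by (auto simp: subsemimodule_zero)
  with T show "subsemimodule (\<Inter> T)" by (fastforce simp: subsemimodule_def)
qed

lemma scale_sum_right: "s *s sum h A = (\<Sum>i\<in>A. s *s h i)"
  by (induction A rule: infinite_finite_induct) (simp_all add: scale_zero_right scale_right_distrib)

lemma scale_left_commute: "s *s (t *s x) = t *s (s *s x)"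
  by (metis mult.commute scale_assoc)

lemma set_prod_zero: "0 \<in> set_prod scale I N"
  unfolding set_prod_def by (rule CollectI, rule exI[of _ 0]) simp

lemma set_prod_add_product:
  assumes "p \<in> set_prod scale I N" "s \<in> I" "x \<in> N"
  shows "p + s *s x \<in> set_prod scale I N"
proof -
  obtain n :: nat and u y where p: "p = (\<Sum>k<n. u k *s y k)" and uy: "\<forall>k<n. u k \<in> I \<and> y k \<in> N"
    using assms(1) unfolding set_prod_def by auto
  have "p + s *s x = (\<Sum>k<Suc n. (u(n := s)) k *s (y(n := x)) k)"
    by (simp add: p)
  moreover have "\<forall>k<Suc n. (u(n := s)) k \<in> I \<and> (y(n := x)) k \<in> N"
    using uy assms(2,3) by auto
  ultimately show ?thesis
    unfolding set_prod_def by blast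
qed

lemma set_prod_product: "s \<in> I \<Longrightarrow> x \<in> N \<Longrightarrow> s *s x \<in> set_prod scale I N"
  using set_prod_add_product[OF set_prod_zero] by fastforce

lemma set_prod_add:
  assumes "p \<in> set_prod scale I N" "q \<in> set_prod scale I N"
  shows "p + q \<in> set_prod scale I N"
proof -
  obtain n :: nat and u y where q: "q = (\<Sum>k<n. u k *s y k)" and uy: "\<forall>k<n. u k \<in> I \<and> y k \<in> N"
    using assms(2) unfolding set_prod_def by auto
  have "p + (\<Sum>k<l. u k *s y k) \<in> set_prod scale I N" if "l \<le> n" for l
    using that
  proof (induction l)
    case (Suc l)
    then show ?case
      using set_prod_add_product[of "p + (\<Sum>k<l. u k *s y k)" I N "u l" "y l"] uy
      by (simp add: add.assoc)
  qed (use assms(1) in simp)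
  then show ?thesis by (simp add: q)
qed

lemma subsemimodule_set_prod:
  assumes "subsemimodule N"
  shows "subsemimodule (set_prod scale I N)"
  unfolding subsemimodule_def
proof (intro conjI ballI allI)
  show "set_prod scale I N \<noteq> {}" using set_prod_zero by blast
next
  fix s p assume "p \<in> set_prod scale I N"
  then obtain n :: nat and u y where p: "p = (\<Sum>k<n. u k *s y k)" and uy: "\<forall>k<n. u k \<in> I \<and> y k \<in> N"
    unfolding set_prod_def by auto
  have "s *s p = (\<Sum>k<n. u k *s (s *s y k))"
    by (simp add: p scale_sum_right scale_left_commute[of s])
  moreover have "\<forall>k<n. u k \<in> I \<and> s *s y k \<in> N"
    using uy assms by (simp add: subsemimodule_scale)
  ultimately show "s *s p \<in> set_prod scale I N"
    unfolding set_prod_def by (intro CollectI exI conjI)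
qed (rule set_prod_add)

text \<open>
  Together with \<open>set_prod_product\<close> and \<open>subsemimodule_set_prod\<close> this is the universal property of
  the product: it is the least subsemimodule that contains all \<open>sx\<close>. The representation by
  explicit finite sums is not opened again below.
\<close>

lemma set_prod_subset:
  assumes "subsemimodule P" "\<And>s x. s \<in> I \<Longrightarrow> x \<in> N \<Longrightarrow> s *s x \<in> P"
  shows "set_prod scale I N \<subseteq> P"
  using assms by (auto simp: set_prod_def intro!: subsemimodule_sum)

text \<open>
  This lemma and the next one reduce inclusions to generators: to show that \<open>sx \<in> P\<close> for all \<open>x\<close>
  in a generated subsemimodule, or for all \<open>s\<close> in a generated ideal, it is enough to look at the
  generators, as the set of good elements is closed under the operations.
\<close>

lemma subsemimodule_transporter:
  assumes "subsemimodule P"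
  shows "subsemimodule {x. s *s x \<in> P}"
proof -
  have "s *s 0 \<in> P" using assms by (simp add: scale_zero_right subsemimodule_zero)
  with assms show ?thesis
    by (auto simp: subsemimodule_def scale_right_distrib scale_left_commute[of s])
qed

lemma ideal_transporter:
  assumes "subsemimodule P"
  shows "is_ideal {s. s *s x \<in> P}"
proof -
  have "0 *s x \<in> P" using assms by (simp add: scale_zero_left subsemimodule_zero)
  with assms show ?thesis
    by (auto simp: is_ideal_def subsemimodule_def scale_left_distrib scale_assoc)
qed

lemma scale_hull_mem:
  assumes "subsemimodule P" "\<And>x. x \<in> X \<Longrightarrow> s *s x \<in> P" "x \<in> subsemimodule hull X"
  shows "s *s x \<in> P"
  using hull_minimal[of X "{x. s *s x \<in> P}" subsemimodule]
    subsemimodule_transporter[OF assms(1), of s] assms(2,3) by blast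

end

section \<open>Powers of ideals\<close>

lemma is_ideal_hull: "is_ideal (is_ideal hull X)"
  using semiring.subsemimodule_hull[of X] by (simp add: is_ideal_iff_subsemimodule hull_def)

lemma is_ideal_power: "is_ideal (ideal_power I k)"
  by (induction k) (auto simp: is_ideal_iff_subsemimodule semiring.subsemimodule_set_prod
      semiring.subsemimodule_def[of UNIV])

lemma ideal_mult: "is_ideal I \<Longrightarrow> a \<in> I \<Longrightarrow> s * a \<in> I"
  by (simp add: is_ideal_def)

lemma ideal_power_Suc_product: "v \<in> I \<Longrightarrow> w \<in> ideal_power I k \<Longrightarrow> v * w \<in> ideal_power I (Suc k)"
  by (simp add: semiring.set_prod_product)

lemma ideal_power_Suc_hull_subset:
  assumes T: "is_ideal T"
    and gen: "\<And>v w. v \<in> X \<Longrightarrow> w \<in> ideal_power (is_ideal hull X) k \<Longrightarrow> v * w \<in> T"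
  shows "ideal_power (is_ideal hull X) (Suc k) \<subseteq> T"
  unfolding ideal_power.simps
proof (rule semiring.set_prod_subset)
  fix v w assume v: "v \<in> is_ideal hull X" and w: "w \<in> ideal_power (is_ideal hull X) k"
  have "is_ideal {v. v * w \<in> T}"
    using T by (intro semiring.ideal_transporter) (simp add: is_ideal_iff_subsemimodule)
  then have "is_ideal hull X \<subseteq> {v. v * w \<in> T}"
    using gen w by (intro hull_minimal) auto
  with v show "v * w \<in> T" by blast
qed (use T in \<open>simp add: is_ideal_iff_subsemimodule\<close>)

lemma ideal_power_mono:
  assumes "I \<subseteq> J"
  shows "ideal_power I k \<subseteq> ideal_power J k"
proof (induction k)
  case (Suc k)
  then have "s * x \<in> ideal_power J (Suc k)" if "s \<in> I" "x \<in> ideal_power I k" for s x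
    using that assms by (intro ideal_power_Suc_product) auto
  then show ?case
    unfolding ideal_power.simps(2)[of I]
    using is_ideal_power[of J "Suc k"]
    by (intro semiring.set_prod_subset) (auto simp: is_ideal_iff_subsemimodule)
qed simp

lemma ideal_power_add_product:
  assumes "u \<in> ideal_power I k" "w \<in> ideal_power I l"
  shows "u * w \<in> ideal_power I (k + l)"
proof -
  have "ideal_power I k \<subseteq> {u. u * w \<in> ideal_power I (k + l)}"
  proof (induction k)
    case 0
    show ?case using assms(2) by (auto intro: ideal_mult[OF is_ideal_power])
  next
    case (Suc k)
    have "semiring.subsemimodule {u. u * w \<in> ideal_power I (Suc k + l)}"
      using semiring.ideal_transporter is_ideal_power unfolding is_ideal_iff_subsemimodule by blast
    moreover have "s * x \<in> {u. u * w \<in> ideal_power I (Suc k + l)}"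
      if "s \<in> I" "x \<in> ideal_power I k" for s x
      using Suc that ideal_power_Suc_product[of s I "x * w" "k + l"] by (auto simp: mult.assoc)
    ultimately show ?case
      unfolding ideal_power.simps(2)[of I k] by (rule semiring.set_prod_subset)
  qed
  with assms(1) show ?thesis by blast
qed

text \<open>
  The reason is that a product of \<open>p + 1\<close> elements of \<open>insert t X\<close> either uses \<open>t\<close> at least once or
  is a product of elements of \<open>X\<close> only. In the proof, \<open>k\<close> counts the factors that have been
  exchanged from \<open>X\<close> to \<open>insert t X\<close>, so that one factor can be split off at a time.
\<close>

lemma ideal_power_insert_subset:
  assumes T: "is_ideal T"
    and t: "\<And>w. w \<in> ideal_power (is_ideal hull insert t X) p \<Longrightarrow> t * w \<in> T"
    and J: "ideal_power (is_ideal hull X) (Suc p) \<subseteq> T"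
  shows "ideal_power (is_ideal hull insert t X) (Suc p) \<subseteq> T"
proof -
  let ?I = "is_ideal hull insert t X" and ?J = "is_ideal hull X"
  have JI: "?J \<subseteq> ?I" by (rule hull_mono) blast
  have "\<forall>u\<in>ideal_power ?J (Suc p - k). ideal_power ?I k \<subseteq> {w. w * u \<in> T}" if "k \<le> Suc p" for k
    using that
  proof (induction k)
    case 0
    then show ?case using J T by (auto intro: ideal_mult)
  next
    case (Suc k)
    show ?case
    proof
      fix u assume u: "u \<in> ideal_power ?J (Suc p - Suc k)"
      show "ideal_power ?I (Suc k) \<subseteq> {w. w * u \<in> T}"
      proof (rule ideal_power_Suc_hull_subset)
        show "is_ideal {w. w * u \<in> T}"
          using T by (intro semiring.ideal_transporter) (simp add: is_ideal_iff_subsemimodule)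
      next
        fix v w assume v: "v \<in> insert t X" and w: "w \<in> ideal_power ?I k"
        from v have "(v * w) * u \<in> T"
        proof
          assume "v = t"
          have "u \<in> ideal_power ?I (p - k)"
            using u ideal_power_mono[OF JI] by auto
          then have "w * u \<in> ideal_power ?I p"
            using ideal_power_add_product[OF w] Suc.prems by fastforce
          then show ?thesis using t \<open>v = t\<close> by (simp add: mult.assoc)
        next
          assume "v \<in> X"
          then have "v * u \<in> ideal_power ?J (Suc (Suc p - Suc k))"
            using u by (intro ideal_power_Suc_product) (auto intro: hull_inc)
          then have "w * (v * u) \<in> T"
            using Suc w by (auto simp: Suc_diff_le)
          then show ?thesis by (simp add: ac_simps)
        qed
        then show "v * w \<in> {w. w * u \<in> T}" by simp
      qed
    qed
  qed
  then have "\<forall>u\<in>ideal_power ?J 0. ideal_power ?I (Suc p) \<subseteq> {w. w * u \<in> T}"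
    by (metis diff_self_eq_0 order_refl)
  then have "ideal_power ?I (Suc p) \<subseteq> {w. w * 1 \<in> T}"
    unfolding ideal_power.simps(1) by (rule bspec) (rule UNIV_I)
  then show ?thesis by simp
qed

section \<open>The Dedekind-Mertens inclusion\<close>

context semimodule
begin

text \<open>
  The coefficients of a product of polynomials, for coefficient sequences. Sequences can be cut off
  and split by case distinctions on the index.
\<close>

definition convolution :: "(nat \<Rightarrow> 's) \<Rightarrow> (nat \<Rightarrow> 'm) \<Rightarrow> nat \<Rightarrow> 'm" where
  "convolution a b k = (\<Sum>i\<le>k. a i *s b (k - i))"

lemma convolution_add_left:
  "convolution (\<lambda>i. a i + a' i) b k = convolution a b k + convolution a' b k"
  by (simp add: convolution_def scale_left_distrib sum.distrib)

lemma convolution_add_right: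
  "convolution a (\<lambda>j. b j + b' j) k = convolution a b k + convolution a b' k"
  by (simp add: convolution_def scale_right_distrib sum.distrib)

lemma convolution_scale_right: "convolution a (\<lambda>j. s *s b j) k = s *s convolution a b k"
  by (simp add: convolution_def scale_sum_right scale_left_commute[of s])

lemma convolution_leading:
  assumes "\<And>i. i > n \<Longrightarrow> a i = 0" "\<And>j. j > m \<Longrightarrow> b j = 0"
  shows "convolution a b (n + m) = a n *s b m"
proof -
  have "convolution a b (n + m) = (\<Sum>i\<in>{n}. a i *s b (n + m - i))"
    unfolding convolution_def
  proof (rule sum.mono_neutral_right)
    show "\<forall>i\<in>{..n + m} - {n}. a i *s b (n + m - i) = 0"
    proof
      fix i assume "i \<in> {..n + m} - {n}"
      then have "i > n \<or> n + m - i > m" by auto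
      then show "a i *s b (n + m - i) = 0"
        using assms by (auto simp: scale_zero_left scale_zero_right)
    qed
  qed auto
  then show ?thesis by simp
qed

lemma subtractiveD:
  "subtractive \<Longrightarrow> subsemimodule N \<Longrightarrow> x + y \<in> N \<Longrightarrow> x \<in> N \<Longrightarrow> y \<in> N"
  unfolding subtractive_def subtractive_subsemimodule_def by blast

text \<open>
  The step that lowers the degree of \<open>b\<close>: after multiplication by the leading coefficient \<open>a n\<close>, the
  top term of \<open>b\<close> becomes a coefficient of the product and can be cancelled, and the induction
  hypothesis applies to what remains. It bounds the remainder in terms of its own product with \<open>a\<close>,
  which lies in \<open>I C\<close>; the additional factor \<open>I\<close> turns \<open>I\<^sup>m\<close> into \<open>I\<^sup>m\<^sup>+\<^sup>1\<close>.
\<close>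

lemma leading_coefficient_mult:
  fixes a :: "nat \<Rightarrow> 's" and b :: "nat \<Rightarrow> 'm" and m n
  defines "I \<equiv> is_ideal hull range a"
    and "C \<equiv> subsemimodule hull range (convolution a b)"
  assumes sub: subtractive
    and a: "\<And>i. i > n \<Longrightarrow> a i = 0" and b: "\<And>j. j > Suc m \<Longrightarrow> b j = 0"
    and IH: "\<And>b' s j. (\<And>j. j > m \<Longrightarrow> b' j = 0) \<Longrightarrow> s \<in> ideal_power I (Suc m) \<Longrightarrow>
        s *s b' j \<in> set_prod scale (ideal_power I m) (subsemimodule hull range (convolution a b'))"
    and s: "s \<in> ideal_power I (Suc m)"
  shows "s *s (a n *s b j) \<in> set_prod scale (ideal_power I (Suc m)) C"
proof -
  define N where "N = set_prod scale (ideal_power I (Suc m)) C"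
  define b' where "b' = (\<lambda>j. if j \<le> m then a n *s b j else 0)"
  define e where "e = (\<lambda>j. if j = Suc m then a n *s b j else 0)"
  have C: "subsemimodule C" unfolding C_def by (rule subsemimodule_hull)
  have IC: "subsemimodule (set_prod scale I C)" by (rule subsemimodule_set_prod[OF C])
  have N: "subsemimodule N" unfolding N_def by (rule subsemimodule_set_prod[OF C])
  have aI: "a i \<in> I" for i unfolding I_def by (auto intro: hull_inc)
  have cC: "convolution a b k \<in> C" for k unfolding C_def by (auto intro: hull_inc)
  have top: "a n *s b (Suc m) \<in> C"
    using convolution_leading[of n a "Suc m" b] a b cC[of "n + Suc m"] by simp
  have "convolution a b' k \<in> set_prod scale I C" for k
  proof (rule subtractiveD[OF sub IC])
    have "(\<lambda>j. e j + b' j) = (\<lambda>j. a n *s b j)"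
      using b by (fastforce simp: e_def b'_def scale_zero_right)
    then have "convolution a e k + convolution a b' k = a n *s convolution a b k"
      by (metis convolution_add_right convolution_scale_right)
    then show "convolution a e k + convolution a b' k \<in> set_prod scale I C"
      using set_prod_product[OF aI cC] by simp
    have "e j \<in> C" for j
      using top subsemimodule_zero[OF C] by (simp add: e_def)
    then show "convolution a e k \<in> set_prod scale I C"
      unfolding convolution_def by (intro subsemimodule_sum[OF IC] set_prod_product aI)
  qed
  then have conv: "subsemimodule hull range (convolution a b') \<subseteq> set_prod scale I C"
    by (intro hull_minimal IC) auto
  have "w *s x \<in> N" if w: "w \<in> ideal_power I m" and x: "x \<in> set_prod scale I C" for w x
  proof -
    have "set_prod scale I C \<subseteq> {x. w *s x \<in> N}"
    proof (rule set_prod_subset[OF subsemimodule_transporter[OF N]])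
      fix v y assume "v \<in> I" "y \<in> C"
      then have "(v * w) *s y \<in> N"
        unfolding N_def using w by (intro set_prod_product ideal_power_Suc_product)
      then show "v *s y \<in> {x. w *s x \<in> N}"
        by (simp add: scale_assoc scale_left_commute[of w])
    qed
    with x show ?thesis by blast
  qed
  then have "set_prod scale (ideal_power I m) (subsemimodule hull range (convolution a b')) \<subseteq> N"
    using conv by (intro set_prod_subset[OF N]) auto
  then have low: "s *s b' j \<in> N"
    using IH[of b' s j] s by (auto simp: b'_def)
  consider "j \<le> m" | "j = Suc m" | "j > Suc m" by linarith
  then have "s *s (a n *s b j) \<in> N"
  proof cases
    case 1
    then show ?thesis using low by (simp add: b'_def)
  next
    case 2
    then show ?thesis unfolding N_def using s top by (auto intro: set_prod_product)
  next
    case 3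
    then show ?thesis using b N by (simp add: scale_zero_right subsemimodule_zero)
  qed
  then show ?thesis by (simp add: N_def)
qed

text \<open>
  The numbers \<open>n\<close> and \<open>m\<close> are only upper bounds for the supports: removing a leading term can
  lower the degree by more than one, or even give zero, and a bound absorbs these cases.
\<close>

lemma dedekind_mertens_mem:
  assumes sub: subtractive
    and "\<And>i. i \<ge> n \<Longrightarrow> a i = 0" "\<And>j. j > m \<Longrightarrow> b j = 0"
    and "s \<in> ideal_power (is_ideal hull range a) (Suc m)"
  shows "s *s b j \<in> set_prod scale (ideal_power (is_ideal hull range a) m)
    (subsemimodule hull range (convolution a b))"
  using assms(2-)
proof (induction m arbitrary: n a b s j)
  case 0
  let ?N = "set_prod scale (ideal_power (is_ideal hull range a) 0)
    (subsemimodule hull range (convolution a b))"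
  have N: "subsemimodule ?N" by (rule subsemimodule_set_prod[OF subsemimodule_hull])
  show ?case
  proof (cases "j = 0")
    case True
    have "ideal_power (is_ideal hull range a) (Suc 0) \<subseteq> {s. s *s b 0 \<in> ?N}"
    proof (rule ideal_power_Suc_hull_subset[OF ideal_transporter[OF N]])
      fix v w assume "v \<in> range a"
      then obtain i where i: "v = a i" by blast
      have "convolution a b (i + 0) = (a i) *s b 0"
        unfolding convolution_def
        using 0(2) by (subst sum.mono_neutral_right[of _ "{i}"]) (auto simp: scale_zero_right)
      then have "v *s b 0 \<in> subsemimodule hull range (convolution a b)"
        unfolding i by (metis hull_inc rangeI)
      then have "w *s (v *s b 0) \<in> ?N" by (intro set_prod_product) auto
      then show "v * w \<in> {s. s *s b 0 \<in> ?N}"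
        by (simp add: scale_assoc scale_left_commute[of w])
    qed
    then show ?thesis using 0 True by blast
  next
    case False
    then show ?thesis using 0(2) N by (simp add: scale_zero_right subsemimodule_zero)
  qed
next
  case (Suc m)
  note IH = Suc.IH and b = \<open>\<And>j. j > Suc m \<Longrightarrow> b j = 0\<close>
  show ?case
    using Suc.prems(1,3)
  proof (induction n arbitrary: a s j)
    case 0
    let ?N = "set_prod scale (ideal_power (is_ideal hull range a) (Suc m))
      (subsemimodule hull range (convolution a b))"
    have N: "subsemimodule ?N" by (rule subsemimodule_set_prod[OF subsemimodule_hull])
    have "ideal_power (is_ideal hull range a) (Suc (Suc m)) \<subseteq> {s. s *s b j \<in> ?N}"
      using 0(1) by (intro ideal_power_Suc_hull_subset[OF ideal_transporter[OF N]])
        (auto simp: scale_zero_left set_prod_zero)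
    then show ?case using 0 by blast
  next
    case (Suc n)
    let ?I = "is_ideal hull range a" and ?C = "subsemimodule hull range (convolution a b)"
    let ?N = "set_prod scale (ideal_power ?I (Suc m)) ?C"
    have a: "a i = 0" if "i > n" for i using Suc.prems(1) that by simp
    have N: "subsemimodule ?N" by (rule subsemimodule_set_prod[OF subsemimodule_hull])
    have lead: "w *s (a n *s b l) \<in> ?N" if "w \<in> ideal_power ?I (Suc m)" for w l
      using a b IH[OF Suc.prems(1)] that by (rule leading_coefficient_mult[OF sub])
    define a' where "a' = (\<lambda>i. if i < n then a i else 0)"
    define h where "h = (\<lambda>i. if i = n then a n else 0)"
    let ?J = "is_ideal hull range a'"
    have "a i \<in> insert (a n) (range a')" for i
    proof (cases "i = n")
      case False
      then have "a i = a' i" using a[of i] by (simp add: a'_def)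
      then show ?thesis by simp
    qed simp
    moreover have "a' i \<in> range a" for i
      using a[of "Suc n"] by (cases "i < n") (auto simp: a'_def intro: range_eqI[of _ _ "Suc n"])
    ultimately have ra: "range a = insert (a n) (range a')" by blast
    then have JI: "?J \<subseteq> ?I" by (intro hull_mono) blast
    \<comment> \<open>\<open>a\<close> is the sum of its leading term \<open>h\<close> and the rest \<open>a'\<close>, and \<open>lead\<close> allows to cancel the
      contribution of \<open>h\<close>.\<close>
    have tail: "w *s convolution a' b k \<in> ?N" if "w \<in> ideal_power ?I (Suc m)" for w k
    proof (rule subtractiveD[OF sub N])
      have "(\<lambda>i. h i + a' i) = a"
        using a by (auto simp: h_def a'_def fun_eq_iff not_less_iff_gr_or_eq)
      then have "convolution h b k + convolution a' b k = convolution a b k"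
        by (metis convolution_add_left)
      then have "w *s convolution h b k + w *s convolution a' b k = w *s convolution a b k"
        by (metis scale_right_distrib)
      also have "\<dots> \<in> ?N" using that by (auto intro!: set_prod_product hull_inc)
      finally show "w *s convolution h b k + w *s convolution a' b k \<in> ?N" .
      show "w *s convolution h b k \<in> ?N"
        unfolding convolution_def[of h] scale_sum_right
        using lead[OF that] by (intro subsemimodule_sum[OF N])
          (auto simp: h_def scale_zero_left scale_zero_right set_prod_zero)
    qed
    have "set_prod scale (ideal_power ?J (Suc m)) (subsemimodule hull range (convolution a' b)) \<subseteq> ?N"
    proof (rule set_prod_subset[OF N])
      fix w x assume w: "w \<in> ideal_power ?J (Suc m)"
        and x: "x \<in> subsemimodule hull range (convolution a' b)"
      have "w \<in> ideal_power ?I (Suc m)" using w ideal_power_mono[OF JI] by blast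
      then show "w *s x \<in> ?N" using tail by (intro scale_hull_mem[OF N _ x]) blast
    qed
    then have J: "ideal_power ?J (Suc (Suc m)) \<subseteq> {s. s *s b j \<in> ?N}"
      using Suc.IH[of a' _ j] by (auto simp: a'_def)
    have "ideal_power (is_ideal hull insert (a n) (range a')) (Suc (Suc m)) \<subseteq> {s. s *s b j \<in> ?N}"
    proof (rule ideal_power_insert_subset[OF ideal_transporter[OF N] _ J])
      fix w assume "w \<in> ideal_power (is_ideal hull insert (a n) (range a')) (Suc m)"
      then show "a n * w \<in> {s. s *s b j \<in> ?N}"
        using lead[of w j] by (simp add: ra[symmetric] scale_assoc scale_left_commute[of w])
    qed
    then show ?case using Suc.prems(2) ra by auto
  qed
qed

text \<open>
  The half of the content formula that holds over every semiring comes from this inclusion.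
\<close>

lemma content_poly_scale_subset:
  "content_submodule (poly_scale f g) \<subseteq> set_prod scale (content_ideal f) (content_submodule g)"
  unfolding content_submodule_def content_ideal_def
  by (intro hull_minimal subsemimodule_set_prod subsemimodule_hull)
    (auto simp: coeff_poly_scale intro!: subsemimodule_sum set_prod_product hull_inc
      subsemimodule_set_prod subsemimodule_hull)

lemma dedekind_mertens:
  assumes subtractive
  shows "set_prod scale (ideal_power (content_ideal f) (Suc (degree g))) (content_submodule g) =
    set_prod scale (ideal_power (content_ideal f) (degree g)) (content_submodule (poly_scale f g))"
    (is "?L = ?R")
proof
  have conv: "convolution (coeff f) (coeff g) = coeff (poly_scale f g)"
    by (simp add: fun_eq_iff convolution_def coeff_poly_scale)
  have R: "subsemimodule ?R"
    unfolding content_submodule_def by (rule subsemimodule_set_prod[OF subsemimodule_hull])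
  have "s *s coeff g j \<in> ?R" if "s \<in> ideal_power (content_ideal f) (Suc (degree g))" for s j
    using dedekind_mertens_mem[OF assms, of "Suc (degree f)" "coeff f" "degree g" "coeff g" s j] that
    unfolding conv content_ideal_def content_submodule_def by (simp add: coeff_eq_0)
  then show "?L \<subseteq> ?R"
    unfolding content_submodule_def[of g]
    by (intro set_prod_subset[OF R]) (erule scale_hull_mem[OF R, rotated], blast)
next
  have L: "subsemimodule ?L"
    unfolding content_submodule_def by (rule subsemimodule_set_prod[OF subsemimodule_hull])
  show "?R \<subseteq> ?L"
  proof (rule set_prod_subset[OF L])
    fix w x assume w: "w \<in> ideal_power (content_ideal f) (degree g)"
      and x: "x \<in> content_submodule (poly_scale f g)"
    have "set_prod scale (content_ideal f) (content_submodule g) \<subseteq> {x. w *s x \<in> ?L}"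
    proof (rule set_prod_subset[OF subsemimodule_transporter[OF L]])
      fix v y assume "v \<in> content_ideal f" "y \<in> content_submodule g"
      then have "(v * w) *s y \<in> ?L" using w by (intro set_prod_product ideal_power_Suc_product)
      then show "v *s y \<in> {x. w *s x \<in> ?L}" by (simp add: scale_assoc scale_left_commute[of w])
    qed
    with x content_poly_scale_subset show "w *s x \<in> ?L" by blast
  qed
qed

section \<open>Subtractivity from the content formula\<close>

lemma ideal_power_UNIV: "ideal_power (UNIV :: 'r::comm_semiring_1 set) k = UNIV"
proof (induction k)
  case (Suc k)
  have "x \<in> ideal_power UNIV (Suc k)" for x :: 'r
    using ideal_power_Suc_product[of x UNIV 1 k] Suc by simp
  then show ?case by blast
qed simp

lemma set_prod_UNIV:
  assumes "subsemimodule N"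
  shows "set_prod scale UNIV N = N"
proof
  show "set_prod scale UNIV N \<subseteq> N"
    using assms by (intro set_prod_subset) (auto intro: subsemimodule_scale)
  show "N \<subseteq> set_prod scale UNIV N"
    using set_prod_product[of 1 UNIV _ N] by (auto simp: scale_one)
qed

lemma subtractive_if_content_formula:
  assumes formula: "\<And>f g. g \<noteq> 0 \<Longrightarrow>
      set_prod scale (ideal_power (content_ideal f) (Suc (degree g))) (content_submodule g) =
      set_prod scale (ideal_power (content_ideal f) (degree g)) (content_submodule (poly_scale f g))"
  shows subtractive
  unfolding subtractive_def subtractive_subsemimodule_def
proof (intro allI impI conjI)
  fix N x y assume N: "subsemimodule N" and xy: "x \<in> N \<and> x + y \<in> N"
  show "y \<in> N"
  proof (cases "x = 0")
    case True
    then show ?thesis using xy by simp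
  next
    case False
    \<comment> \<open>With \<open>x\<close> on both sides of \<open>y\<close>, multiplication by \<open>1 + X\<close> produces only \<open>x\<close> and \<open>x + y\<close>.\<close>
    define f :: "'s poly" where "f = [:1, 1:]"
    define g where "g = pCons x (pCons y (pCons x 0))"
    have g: "g \<noteq> 0" using False by (simp add: g_def)
    have "1 \<in> range (coeff f)"
      by (rule range_eqI[of _ _ 0]) (simp add: f_def)
    then have "1 \<in> content_ideal f"
      unfolding content_ideal_def by (rule hull_inc)
    then have f: "content_ideal f = UNIV"
      using ideal_mult[OF is_ideal_hull, of 1 "range (coeff f)"] by (auto simp: content_ideal_def)
    have "coeff (poly_scale f g) k \<in> N" for k
    proof -
      have "coeff (poly_scale f g) k = coeff g k + (case k of 0 \<Rightarrow> 0 | Suc l \<Rightarrow> coeff g l)"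
      proof (cases k)
        case (Suc l)
        have "(\<Sum>i\<le>l. coeff f (Suc i) *s coeff g (l - i)) =
            (\<Sum>i\<le>l. if i = 0 then coeff g l else 0)"
          by (intro sum.cong)
            (auto simp: f_def coeff_pCons scale_one scale_zero_left split: nat.splits)
        then show ?thesis
          unfolding Suc coeff_poly_scale by (subst sum.atMost_Suc_shift) (simp add: f_def scale_one)
      qed (simp add: coeff_poly_scale f_def scale_one)
      also have "\<dots> \<in> N"
        using xy N by (auto simp: g_def coeff_pCons add.commute subsemimodule_zero split: nat.splits)
      finally show ?thesis .
    qed
    then have "content_submodule (poly_scale f g) \<subseteq> N"
      unfolding content_submodule_def by (intro hull_minimal N) auto
    moreover have "content_submodule g = content_submodule (poly_scale f g)"
      using formula[OF g, of f] unfolding f ideal_power_UNIV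
      by (simp add: set_prod_UNIV subsemimodule_hull content_submodule_def)
    moreover have "coeff g 1 \<in> content_submodule g"
      unfolding content_submodule_def by (auto intro: hull_inc)
    ultimately show ?thesis by (auto simp: g_def)
  qed
qed

end

theorem theorem2:
  fixes scale :: "'s::comm_semiring_1 \<Rightarrow> 'm::comm_monoid_add \<Rightarrow> 'm"
  assumes "semimodule scale"
  shows "semimodule.subtractive scale \<longleftrightarrow>
    (\<forall>(f::'s poly) (g::'m poly) (m::nat). g \<noteq> 0 \<and> degree g = m \<longrightarrow>
       set_prod scale (ideal_power (content_ideal f) (m + 1)) (semimodule.content_submodule scale g) =
       set_prod scale (ideal_power (content_ideal f) m)
         (semimodule.content_submodule scale (semimodule.poly_scale scale f g)))"
proof -
  interpret semimodule scale by (rule assms)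
  show ?thesis
    using dedekind_mertens subtractive_if_content_formula by auto
qed

end
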